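(* Let $A$ be a Banach algebra, let $\phi\in\Delta(A)$, and let $e\in A$ be an element of the closed unit ball of $A$ with $\phi(e)\neq 0$. If $A$ is $\phi$-biflat, then $A_e$ is $\psi$-biflat, where $\psi=\phi(e)\phi$.
   Context: For a Banach algebra $A$ and an element $e$ of the closed unit ball $\overline{B^0_1}$ of $A$ (so $\|e\|\le 1$), $A_e$ denotes the Banach algebra whose underlying Banach space is $A$ and whose product is $a\ast b=aeb$. $\Delta(A)$ denotes the set of all non-zero multiplicative linear functionals on $A$. If $\phi\in\Delta(A)$ and $\phi(e)\neq0$, then $\phi(e)\phi$ (the functional $a\mapsto\phi(e)\phi(a)$) is a non-zero multiplicative linear functional on $A_e$. For $\phi\in\Delta(A)$, $\tilde\phi$ denotes its extension to $A^{**}$ given by $\tilde\phi(F)=F(\phi)$. For a Banach algebra $A$, the projective tensor product $A\otimes_p A$ is a Banach $A$-bimodule via $a\cdot(b\otimes c)=ab\otimes c$ and $(b\otimes c)\cdot a=b\otimes ca$, and $\pi_A:A\otimes_pA\to A$ is the bounded linear map determined by $\pi_A(a\otimes b)=ab$ (for $A_e$ all of these are formed with the product $\ast$). The second dual $(A\otimes_pA)^{**}$ carries the canonical dual $A$-bimodule structure, and $\pi_A^{**}:(A\otimes_pA)^{**}\to A^{**}$ is the second adjoint of $\pi_A$. An $A$-bimodule morphism $T:X\to Y$ between Banach $A$-bimodules is a linear map with $T(a\cdot x)=a\cdot T(x)$ and $T(x\cdot a)=T(x)\cdot a$ for all $a\in A$, $x\in X$. For $\phi\in\Delta(A)$, $A$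 is called $\phi$-biflat if there exists a bounded $A$-bimodule morphism $\rho:A\to(A\otimes_pA)^{**}$ such that $\tilde\phi\circ\pi_A^{**}\circ\rho=\phi$. *)

theory Defs
  imports "HOL-Analysis.Analysis"
begin

section \<open>Complex normed spaces\<close>

class complex_vector = real_vector +
  fixes scaleC :: "complex \<Rightarrow> 'a \<Rightarrow> 'a"  (infixr \<open>*\<^sub>C\<close> 75)
  assumes scaleC_add_right: "c *\<^sub>C (x + y) = c *\<^sub>C x + c *\<^sub>C y"
    and scaleC_add_left: "(c + d) *\<^sub>C x = c *\<^sub>C x + d *\<^sub>C x"
    and scaleC_scaleC: "c *\<^sub>C d *\<^sub>C x = (c * d) *\<^sub>C x"
    and scaleC_of_real: "of_real r *\<^sub>C x = r *\<^sub>R x"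

class complex_normed_vector = complex_vector + real_normed_vector +
  assumes norm_scaleC: "norm (c *\<^sub>C x) = cmod c * norm x"

class cbanach = complex_normed_vector + banach

instantiation complex :: cbanach
begin
definition scaleC_complex :: "complex \<Rightarrow> complex \<Rightarrow> complex" where
  "scaleC_complex c x = c * x"
instance
  by standard (auto simp: scaleC_complex_def algebra_simps norm_mult scaleR_conv_of_real)
end

lemma scaleC_one [simp]: "1 *\<^sub>C x = (x :: 'a :: complex_vector)"
  using scaleC_of_real[of 1 x] by simp

lemma scaleC_zero_left [simp]: "0 *\<^sub>C x = (0 :: 'a :: complex_vector)"
  using scaleC_of_real[of 0 x] by simp

lemma scaleC_minus_one: "(-1) *\<^sub>C x = - (x :: 'a :: complex_vector)"
  using scaleC_of_real[of "-1" x] by simp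

lemma scaleC_zero_right [simp]: "c *\<^sub>C 0 = (0 :: 'a :: complex_vector)"
  using scaleC_add_right[of c 0 0] by simp

lemma scaleC_minus_right: "c *\<^sub>C (- x) = - (c *\<^sub>C (x :: 'a :: complex_vector))"
  using scaleC_add_right[of c x "- x"] by (simp add: eq_neg_iff_add_eq_0 add.commute)

lemma scaleC_diff_right: "c *\<^sub>C (x - y) = c *\<^sub>C x - c *\<^sub>C (y :: 'a :: complex_vector)"
  using scaleC_add_right[of c x "- y"] by (simp add: scaleC_minus_right)

lemma bounded_linear_scaleC: "bounded_linear (\<lambda>x :: 'a :: complex_normed_vector. c *\<^sub>C x)"
proof (rule bounded_linear_intro[where K = "cmod c"])
  fix x y :: 'a and r :: real
  show "c *\<^sub>C (x + y) = c *\<^sub>C x + c *\<^sub>C y" by (rule scaleC_add_right)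
  show "c *\<^sub>C (r *\<^sub>R x) = r *\<^sub>R (c *\<^sub>C x)"
    unfolding scaleC_of_real[symmetric] scaleC_scaleC by (simp add: mult.commute)
  show "norm (c *\<^sub>C x) \<le> norm x * cmod c" by (simp add: norm_scaleC mult.commute)
qed

definition clinear :: "('a :: complex_vector \<Rightarrow> 'b :: complex_vector) \<Rightarrow> bool" where
  "clinear f \<longleftrightarrow> (\<forall>x y. f (x + y) = f x + f y) \<and> (\<forall>c x. f (c *\<^sub>C x) = c *\<^sub>C f x)"

definition bounded_clinear :: "('a :: complex_normed_vector \<Rightarrow> 'b :: complex_normed_vector) \<Rightarrow> bool" where
  "bounded_clinear f \<longleftrightarrow> clinear f \<and> (\<exists>K. \<forall>x. norm (f x) \<le> norm x * K)"

lemma bounded_clinear_iff: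
  "bounded_clinear f \<longleftrightarrow> bounded_linear f \<and> (\<forall>c x. f (c *\<^sub>C x) = c *\<^sub>C f x)"
proof
  assume f: "bounded_clinear f"
  then obtain K where K: "\<And>x. norm (f x) \<le> norm x * K" by (auto simp: bounded_clinear_def)
  have "bounded_linear f"
    by (rule bounded_linear_intro[where K = K])
      (use f K in \<open>auto simp: bounded_clinear_def clinear_def simp flip: scaleC_of_real\<close>)
  with f show "bounded_linear f \<and> (\<forall>c x. f (c *\<^sub>C x) = c *\<^sub>C f x)"
    by (auto simp: bounded_clinear_def clinear_def)
next
  assume f: "bounded_linear f \<and> (\<forall>c x. f (c *\<^sub>C x) = c *\<^sub>C f x)"
  then interpret bounded_linear f by simp
  show "bounded_clinear f"
    using f bounded by (auto simp: bounded_clinear_def clinear_def add)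
qed


section \<open>The Banach space of bounded complex-linear maps\<close>

text \<open>A subspace of the library's space of bounded real-linear maps, with the operator norm
  inherited from there.\<close>

typedef (overloaded) ('a, 'b) cblinfun =
  "{f :: 'a :: complex_normed_vector \<Rightarrow>\<^sub>L 'b :: complex_normed_vector.
      \<forall>c x. blinfun_apply f (c *\<^sub>C x) = c *\<^sub>C blinfun_apply f x}"
  by (rule exI[of _ 0]) simp

setup_lifting type_definition_cblinfun

type_notation cblinfun (\<open>(_ \<Rightarrow>\<^sub>C\<^sub>L /_)\<close> [22, 21] 21)

type_synonym 'a cdual = "'a \<Rightarrow>\<^sub>C\<^sub>L complex"

lift_definition cblinfun_apply ::
    "('a :: complex_normed_vector) \<Rightarrow>\<^sub>C\<^sub>L ('b :: complex_normed_vector) \<Rightarrow> 'a \<Rightarrow> 'b" (infixr \<open>*\<^sub>V\<close> 70)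
  is blinfun_apply .

definition CBlinfun ::
    "(('a :: complex_normed_vector) \<Rightarrow> ('b :: complex_normed_vector)) \<Rightarrow> 'a \<Rightarrow>\<^sub>C\<^sub>L 'b" where
  "CBlinfun f = (THE T. \<forall>x. T *\<^sub>V x = f x)"

lemma cblinfun_eqI: "(\<And>x. S *\<^sub>V x = T *\<^sub>V x) \<Longrightarrow> S = T"
  by transfer (auto intro: blinfun_eqI)

lemma CBlinfun_apply [simp]:
  assumes "bounded_clinear f"
  shows "CBlinfun f *\<^sub>V x = f x"
proof -
  have Abs: "\<forall>x. Abs_cblinfun (Blinfun f) *\<^sub>V x = f x"
    using assms by (auto simp: cblinfun_apply_def bounded_clinear_iff Abs_cblinfun_inverse bounded_linear_Blinfun_apply)
  then have "\<forall>x. CBlinfun f *\<^sub>V x = f x"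
    unfolding CBlinfun_def by (rule theI) (use Abs in \<open>auto intro!: cblinfun_eqI\<close>)
  then show ?thesis by blast
qed

lemma bounded_clinear_apply [simp]: "bounded_clinear (cblinfun_apply T)"
  unfolding bounded_clinear_iff by transfer (auto simp: blinfun.bounded_linear_right)

instantiation cblinfun :: (complex_normed_vector, complex_normed_vector) complex_normed_vector
begin

lift_definition zero_cblinfun :: "'a \<Rightarrow>\<^sub>C\<^sub>L 'b" is 0 by simp
lift_definition plus_cblinfun :: "'a \<Rightarrow>\<^sub>C\<^sub>L 'b \<Rightarrow> 'a \<Rightarrow>\<^sub>C\<^sub>L 'b \<Rightarrow> 'a \<Rightarrow>\<^sub>C\<^sub>L 'b" is "(+)"
  by (simp add: blinfun.add_left scaleC_add_right)
lift_definition uminus_cblinfun :: "'a \<Rightarrow>\<^sub>C\<^sub>L 'b \<Rightarrow> 'a \<Rightarrow>\<^sub>C\<^sub>L 'b" is uminus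
  by (simp add: blinfun.minus_left scaleC_minus_right)
lift_definition minus_cblinfun :: "'a \<Rightarrow>\<^sub>C\<^sub>L 'b \<Rightarrow> 'a \<Rightarrow>\<^sub>C\<^sub>L 'b \<Rightarrow> 'a \<Rightarrow>\<^sub>C\<^sub>L 'b" is "(-)"
  by (simp add: blinfun.diff_left scaleC_diff_right)
lift_definition scaleR_cblinfun :: "real \<Rightarrow> 'a \<Rightarrow>\<^sub>C\<^sub>L 'b \<Rightarrow> 'a \<Rightarrow>\<^sub>C\<^sub>L 'b" is "(*\<^sub>R)"
  by (simp add: blinfun.scaleR_left scaleC_scaleC mult.commute flip: scaleC_of_real)
lift_definition scaleC_cblinfun :: "complex \<Rightarrow> 'a \<Rightarrow>\<^sub>C\<^sub>L 'b \<Rightarrow> 'a \<Rightarrow>\<^sub>C\<^sub>L 'b" is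
  "\<lambda>c f. Blinfun (\<lambda>x. c *\<^sub>C blinfun_apply f x)"
proof -
  fix c d and f :: "'a \<Rightarrow>\<^sub>L 'b" and x
  assume f: "\<And>c x. blinfun_apply f (c *\<^sub>C x) = c *\<^sub>C blinfun_apply f x"
  have "bounded_linear (\<lambda>x. c *\<^sub>C blinfun_apply f x)"
    by (rule bounded_linear_compose[OF bounded_linear_scaleC blinfun.bounded_linear_right])
  then show "blinfun_apply (Blinfun (\<lambda>x. c *\<^sub>C blinfun_apply f x)) (d *\<^sub>C x) =
      d *\<^sub>C blinfun_apply (Blinfun (\<lambda>x. c *\<^sub>C blinfun_apply f x)) x"
    by (simp add: bounded_linear_Blinfun_apply f scaleC_scaleC mult.commute)
qed
lift_definition norm_cblinfun :: "'a \<Rightarrow>\<^sub>C\<^sub>L 'b \<Rightarrow> real" is norm .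
lift_definition dist_cblinfun :: "'a \<Rightarrow>\<^sub>C\<^sub>L 'b \<Rightarrow> 'a \<Rightarrow>\<^sub>C\<^sub>L 'b \<Rightarrow> real" is dist .
lift_definition sgn_cblinfun :: "'a \<Rightarrow>\<^sub>C\<^sub>L 'b \<Rightarrow> 'a \<Rightarrow>\<^sub>C\<^sub>L 'b" is sgn
  by (simp add: sgn_div_norm blinfun.scaleR_left scaleC_scaleC mult.commute flip: scaleC_of_real)

definition uniformity_cblinfun :: "(('a \<Rightarrow>\<^sub>C\<^sub>L 'b) \<times> ('a \<Rightarrow>\<^sub>C\<^sub>L 'b)) filter" where
  "uniformity_cblinfun = (INF e\<in>{0<..}. principal {(x, y). dist x y < e})"
definition open_cblinfun :: "('a \<Rightarrow>\<^sub>C\<^sub>L 'b) set \<Rightarrow> bool" where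
  "open_cblinfun U = (\<forall>x\<in>U. \<forall>\<^sub>F (x', y) in uniformity. x' = x \<longrightarrow> y \<in> U)"

lemma cblinfun_apply_scaleC_aux: "(c *\<^sub>C T) *\<^sub>V x = c *\<^sub>C (T *\<^sub>V x)"
  by transfer (simp add: bounded_linear_Blinfun_apply
      bounded_linear_compose[OF bounded_linear_scaleC blinfun.bounded_linear_right])

instance
proof
  fix S T U :: "'a \<Rightarrow>\<^sub>C\<^sub>L 'b" and a b :: real and c d :: complex
  show "S + T + U = S + (T + U)" "S + T = T + S" "0 + S = S" "- S + S = 0" "S - T = S + - T"
    by (transfer; simp)+
  show "a *\<^sub>R (S + T) = a *\<^sub>R S + a *\<^sub>R T" "(a + b) *\<^sub>R S = a *\<^sub>R S + b *\<^sub>R S"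
    "a *\<^sub>R b *\<^sub>R S = (a * b) *\<^sub>R S" "1 *\<^sub>R S = S"
    by (transfer; simp add: algebra_simps)+
  have add: "(S + T) *\<^sub>V x = S *\<^sub>V x + T *\<^sub>V x" for S T :: "'a \<Rightarrow>\<^sub>C\<^sub>L 'b" and x
    by transfer (simp add: blinfun.add_left)
  show "c *\<^sub>C (S + T) = c *\<^sub>C S + c *\<^sub>C T" "(c + d) *\<^sub>C S = c *\<^sub>C S + d *\<^sub>C S"
    "c *\<^sub>C d *\<^sub>C S = (c * d) *\<^sub>C S"
    by (rule cblinfun_eqI, simp add: add cblinfun_apply_scaleC_aux scaleC_add_left scaleC_add_right scaleC_scaleC)+
  have "(a *\<^sub>R S) *\<^sub>V x = a *\<^sub>R (S *\<^sub>V x)" for x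
    by transfer (simp add: blinfun.scaleR_left)
  then show "of_real a *\<^sub>C S = a *\<^sub>R S"
    by (intro cblinfun_eqI) (simp add: cblinfun_apply_scaleC_aux scaleC_of_real)
  show "dist S T = norm (S - T)" by transfer (simp add: dist_norm)
  show "sgn S = inverse (norm S) *\<^sub>R S" by transfer (simp add: sgn_div_norm)
  show "uniformity = (INF e\<in>{0<..}. principal {(x, y). dist x (y :: 'a \<Rightarrow>\<^sub>C\<^sub>L 'b) < e})"
    by (rule uniformity_cblinfun_def)
  show "open V = (\<forall>x\<in>V. \<forall>\<^sub>F (x', y) in uniformity. x' = x \<longrightarrow> y \<in> V)" for V :: "('a \<Rightarrow>\<^sub>C\<^sub>L 'b) set"
    by (rule open_cblinfun_def)
  show "norm S = 0 \<longleftrightarrow> S = 0" by transfer simp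
  show "norm (S + T) \<le> norm S + norm T" by transfer (rule norm_triangle_ineq)
  show "norm (a *\<^sub>R S) = \<bar>a\<bar> * norm S" by transfer simp
  have bound: "norm (T *\<^sub>V x) \<le> norm T * norm x" for T :: "'a \<Rightarrow>\<^sub>C\<^sub>L 'b" and x
    by transfer (rule norm_blinfun)
  have le: "norm T \<le> K" if "0 \<le> K" "\<And>x. norm (T *\<^sub>V x) \<le> K * norm x" for T :: "'a \<Rightarrow>\<^sub>C\<^sub>L 'b" and K
    using that by transfer (rule norm_blinfun_bound)
  have norm_T: "0 \<le> norm T" for T :: "'a \<Rightarrow>\<^sub>C\<^sub>L 'b"
    by transfer simp
  have le2: "norm (c *\<^sub>C S) \<le> cmod c * norm S" for c and S :: "'a \<Rightarrow>\<^sub>C\<^sub>L 'b"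
    by (rule le) (auto simp: cblinfun_apply_scaleC_aux norm_scaleC mult.assoc intro!: mult_left_mono bound mult_nonneg_nonneg
        simp: norm_T)
  have "cmod c * norm S \<le> norm (c *\<^sub>C S)"
  proof (cases "c = 0")
    case False
    have "inverse c *\<^sub>C c *\<^sub>C S = S"
      by (rule cblinfun_eqI) (simp add: cblinfun_apply_scaleC_aux scaleC_scaleC False)
    with le2[of "inverse c" "c *\<^sub>C S"] show ?thesis
      using False by (simp add: norm_divide field_simps)
  qed (simp add: norm_T)
  with le2[of c S] show "norm (c *\<^sub>C S) = cmod c * norm S" by simp
qed

end

lemma norm_cblinfun_apply: "norm (T *\<^sub>V x) \<le> norm T * norm x"
  by transfer (rule norm_blinfun)

lemma norm_cblinfun_bound: "0 \<le> K \<Longrightarrow> (\<And>x. norm (T *\<^sub>V x) \<le> K * norm x) \<Longrightarrow> norm T \<le> K"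
  by transfer (rule norm_blinfun_bound)

lemma cblinfun_apply_add: "T *\<^sub>V (x + y) = T *\<^sub>V x + T *\<^sub>V y"
  by transfer (simp add: blinfun.add_right)

lemma cblinfun_apply_scaleC: "T *\<^sub>V (c *\<^sub>C x) = c *\<^sub>C (T *\<^sub>V x)"
  by transfer simp

lemma cblinfun_add_apply: "(S + T) *\<^sub>V x = S *\<^sub>V x + T *\<^sub>V x"
  by transfer (simp add: blinfun.add_left)

lemma cblinfun_scaleC_apply: "(c *\<^sub>C T) *\<^sub>V x = c *\<^sub>C (T *\<^sub>V x)"
  by (rule cblinfun_apply_scaleC_aux)

instance cblinfun :: (complex_normed_vector, cbanach) cbanach
proof
  fix X :: "nat \<Rightarrow> 'a \<Rightarrow>\<^sub>C\<^sub>L 'b"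
  assume "Cauchy X"
  define Y where "Y n = Rep_cblinfun (X n)" for n
  have dist_Y: "dist (Rep_cblinfun S) (Rep_cblinfun T) = dist S T" for S T :: "'a \<Rightarrow>\<^sub>C\<^sub>L 'b"
    by transfer simp
  have "Cauchy Y" using \<open>Cauchy X\<close> by (simp add: Cauchy_def Y_def dist_Y)
  then obtain L where L: "Y \<longlonglongrightarrow> L" by (auto simp: Cauchy_convergent_iff convergent_def)
  have "blinfun_apply L (c *\<^sub>C x) = c *\<^sub>C blinfun_apply L x" for c x
  proof (rule LIMSEQ_unique)
    show "(\<lambda>n. blinfun_apply (Y n) (c *\<^sub>C x)) \<longlonglongrightarrow> blinfun_apply L (c *\<^sub>C x)"
      by (intro tendsto_intros L)
    have "(\<lambda>n. c *\<^sub>C blinfun_apply (Y n) x) \<longlonglongrightarrow> c *\<^sub>C blinfun_apply L x"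
      by (intro bounded_linear.tendsto[OF bounded_linear_scaleC] tendsto_intros L)
    moreover have "blinfun_apply (Y n) (c *\<^sub>C x) = c *\<^sub>C blinfun_apply (Y n) x" for n
      using Rep_cblinfun[of "X n"] by (simp add: Y_def)
    ultimately show "(\<lambda>n. blinfun_apply (Y n) (c *\<^sub>C x)) \<longlonglongrightarrow> c *\<^sub>C blinfun_apply L x" by simp
  qed
  then have "Rep_cblinfun (Abs_cblinfun L) = L" by (simp add: Abs_cblinfun_inverse)
  then have "X \<longlonglongrightarrow> Abs_cblinfun L"
    using L by (simp add: tendsto_dist_iff[of X] tendsto_dist_iff[of Y] Y_def flip: dist_Y)
  then show "convergent X" by (auto simp: convergent_def)
qed

text \<open>The adjoint \<open>T\<^sup>* f = f \<circ> T\<close>.\<close>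

definition adj ::
    "('a :: complex_normed_vector) \<Rightarrow>\<^sub>C\<^sub>L ('b :: complex_normed_vector) \<Rightarrow> 'b cdual \<Rightarrow>\<^sub>C\<^sub>L 'a cdual" where
  "adj T = CBlinfun (\<lambda>f. CBlinfun (\<lambda>x. f *\<^sub>V T *\<^sub>V x))"

lemma adj_apply [simp]: "(adj T *\<^sub>V f) *\<^sub>V x = f *\<^sub>V T *\<^sub>V x"
proof -
  have bound: "norm (f *\<^sub>V T *\<^sub>V x) \<le> (norm T * norm f) * norm x" for f :: "'b cdual" and x
    using norm_cblinfun_apply[of f "T *\<^sub>V x"] mult_left_mono[OF norm_cblinfun_apply[of T x], of "norm f"]
    by (simp add: mult_ac)
  then have bd: "bounded_clinear (\<lambda>x. f *\<^sub>V T *\<^sub>V x)" for f :: "'b cdual"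
    unfolding bounded_clinear_def clinear_def
    by (auto simp: cblinfun_apply_add cblinfun_apply_scaleC mult.commute intro!: exI[of _ "norm T * norm f"])
  define G where "G f = CBlinfun (\<lambda>x. f *\<^sub>V T *\<^sub>V x)" for f :: "'b cdual"
  have G: "G f *\<^sub>V x = f *\<^sub>V T *\<^sub>V x" for f :: "'b cdual" and x
    by (simp add: G_def bd)
  have "norm (G f) \<le> norm f * norm T" for f :: "'b cdual"
    by (rule norm_cblinfun_bound) (use bound[of f] in \<open>auto simp: G mult_ac\<close>)
  then have "bounded_clinear G"
    unfolding bounded_clinear_def clinear_def
    by (auto intro!: cblinfun_eqI simp: G cblinfun_add_apply cblinfun_scaleC_apply)
  then have "adj T = CBlinfun G" "bounded_clinear G" by (simp_all add: adj_def G_def[abs_def])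
  then show ?thesis by (simp add: G)
qed


section \<open>The projective tensor product\<close>

subsection \<open>The algebraic tensor product\<close>

text \<open>The list \<open>[(a\<^sub>1, b\<^sub>1), \<dots>, (a\<^sub>n, b\<^sub>n)]\<close> stands for the formal sum
  \<open>a\<^sub>1 \<otimes> b\<^sub>1 + \<dots> + a\<^sub>n \<otimes> b\<^sub>n\<close>; the algebraic tensor product over the complex numbers is obtained by
  factoring out the congruence that the usual relations generate.\<close>

inductive tensor_eq ::
    "('a :: complex_vector \<times> 'b :: complex_vector) list \<Rightarrow> ('a \<times> 'b) list \<Rightarrow> bool" where
  refl: "tensor_eq s s"
| sym: "tensor_eq s t \<Longrightarrow> tensor_eq t s"
| trans: "tensor_eq s t \<Longrightarrow> tensor_eq t u \<Longrightarrow> tensor_eq s u"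
| append: "tensor_eq s t \<Longrightarrow> tensor_eq s' t' \<Longrightarrow> tensor_eq (s @ s') (t @ t')"
| commute: "tensor_eq (s @ t) (t @ s)"
| zero: "tensor_eq [(0, b)] []"
| add_left: "tensor_eq [(a + a', b)] [(a, b), (a', b)]"
| add_right: "tensor_eq [(a, b + b')] [(a, b), (a, b')]"
| scale: "tensor_eq [(c *\<^sub>C a, b)] [(a, c *\<^sub>C b)]"

quotient_type (overloaded) ('a, 'b) atensor =
    "('a :: complex_vector \<times> 'b :: complex_vector) list" / tensor_eq
proof (rule equivpI)
  show "reflp (tensor_eq :: ('a \<times> 'b) list \<Rightarrow> _)" by (rule reflpI) (rule tensor_eq.refl)
  show "symp (tensor_eq :: ('a \<times> 'b) list \<Rightarrow> _)" by (rule sympI) (rule tensor_eq.sym)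
  show "transp (tensor_eq :: ('a \<times> 'b) list \<Rightarrow> _)" by (rule transpI) (rule tensor_eq.trans)
qed

lemma tensor_eq_scaleC:
  "tensor_eq s t \<Longrightarrow> tensor_eq (map (\<lambda>(a, b). (c *\<^sub>C a, b)) s) (map (\<lambda>(a, b). (c *\<^sub>C a, b)) t)"
proof (induction rule: tensor_eq.induct)
  case (scale d a b)
  then show ?case using tensor_eq.scale[of d "c *\<^sub>C a" b] by (simp add: scaleC_scaleC mult.commute)
qed (auto simp: scaleC_add_right intro: tensor_eq.intros)

instantiation atensor :: (complex_vector, complex_vector) complex_vector
begin

lift_definition zero_atensor :: "('a, 'b) atensor" is "[]" .
lift_definition plus_atensor :: "('a, 'b) atensor \<Rightarrow> ('a, 'b) atensor \<Rightarrow> ('a, 'b) atensor" is "(@)"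
  by (rule tensor_eq.append)
lift_definition scaleC_atensor :: "complex \<Rightarrow> ('a, 'b) atensor \<Rightarrow> ('a, 'b) atensor" is
  "\<lambda>c. map (\<lambda>(a, b). (c *\<^sub>C a, b))"
  by (rule tensor_eq_scaleC)
definition uminus_atensor :: "('a, 'b) atensor \<Rightarrow> ('a, 'b) atensor" where
  "uminus_atensor u = (-1) *\<^sub>C u"
definition minus_atensor :: "('a, 'b) atensor \<Rightarrow> ('a, 'b) atensor \<Rightarrow> ('a, 'b) atensor" where
  "minus_atensor u v = u + (-1) *\<^sub>C v"
definition scaleR_atensor :: "real \<Rightarrow> ('a, 'b) atensor \<Rightarrow> ('a, 'b) atensor" where
  "scaleR_atensor r u = of_real r *\<^sub>C u"

instance
proof
  fix u v w :: "('a, 'b) atensor" and r r' :: real and c d :: complex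
  have assoc: "u + v + w = u + (v + w)" for u v w :: "('a, 'b) atensor"
    by transfer (simp add: tensor_eq.refl)
  have comm: "u + v = v + u" for u v :: "('a, 'b) atensor"
    by transfer (rule tensor_eq.commute)
  have lcomm: "u + (v + w) = v + (u + w)" for u v w :: "('a, 'b) atensor"
    using assoc[of u v w] assoc[of v u w] comm[of u v] by simp
  have zero: "0 + u = u" for u :: "('a, 'b) atensor"
    by transfer (simp add: tensor_eq.refl)
  have add: "c *\<^sub>C (u + v) = c *\<^sub>C u + c *\<^sub>C v" for c and u v :: "('a, 'b) atensor"
    by transfer (simp add: tensor_eq.refl)
  have scale: "c *\<^sub>C d *\<^sub>C u = (c * d) *\<^sub>C u" for c d and u :: "('a, 'b) atensor"
    by transfer (simp add: scaleC_scaleC tensor_eq.refl case_prod_unfold comp_def)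
  have one: "1 *\<^sub>C u = u" for u :: "('a, 'b) atensor"
    by transfer (simp add: tensor_eq.refl case_prod_unfold)
  have add': "(c + d) *\<^sub>C u = c *\<^sub>C u + d *\<^sub>C u" for c d and u :: "('a, 'b) atensor"
  proof -
    have single: "(c + d) *\<^sub>C abs_atensor [(a, b)] = c *\<^sub>C abs_atensor [(a, b)] + d *\<^sub>C abs_atensor [(a, b)]"
      for a :: 'a and b :: 'b
      by transfer (simp add: scaleC_add_left tensor_eq.add_left)
    have split: "abs_atensor (x # s) = abs_atensor [x] + abs_atensor s" for x and s :: "('a \<times> 'b) list"
      by transfer (simp add: tensor_eq.refl)
    have "(c + d) *\<^sub>C abs_atensor s = c *\<^sub>C abs_atensor s + d *\<^sub>C abs_atensor s" for s :: "('a \<times> 'b) list"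
    proof (induction s)
      case Nil
      show ?case by transfer (simp add: tensor_eq.refl)
    next
      case (Cons x s)
      obtain a b where x: "x = (a, b)" by fastforce
      have "(c + d) *\<^sub>C abs_atensor (x # s) =
          (c *\<^sub>C abs_atensor [x] + d *\<^sub>C abs_atensor [x]) + (c *\<^sub>C abs_atensor s + d *\<^sub>C abs_atensor s)"
        unfolding split[of x s] add Cons.IH by (simp add: x single)
      also have "\<dots> = (c *\<^sub>C abs_atensor [x] + c *\<^sub>C abs_atensor s) + (d *\<^sub>C abs_atensor [x] + d *\<^sub>C abs_atensor s)"
        by (simp only: assoc comm lcomm)
      also have "\<dots> = c *\<^sub>C abs_atensor (x # s) + d *\<^sub>C abs_atensor (x # s)"
        unfolding split[of x s] add ..
      finally show ?case .
    qed
    then show ?thesis by (metis Quotient_atensor Quotient_abs_rep)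
  qed
  have null: "0 *\<^sub>C u = 0" for u :: "('a, 'b) atensor"
  proof transfer
    fix s :: "('a \<times> 'b) list"
    show "tensor_eq (map (\<lambda>(a, b). (0 *\<^sub>C a, b)) s) []"
    proof (induction s)
      case (Cons x s)
      then show ?case
        using tensor_eq.append[OF tensor_eq.zero[of "snd x"] Cons.IH] by (simp add: case_prod_unfold)
    qed (simp add: tensor_eq.refl)
  qed
  show "u + v + w = u + (v + w)" by (rule assoc)
  show "u + v = v + u" by (rule comm)
  show "0 + u = u" by (rule zero)
  show "- u + u = 0" using add'[of "-1" 1 u] by (simp add: uminus_atensor_def one null)
  show "u - v = u + - v" by (simp add: uminus_atensor_def minus_atensor_def)
  show "c *\<^sub>C (u + v) = c *\<^sub>C u + c *\<^sub>C v" by (rule add)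
  show "(c + d) *\<^sub>C u = c *\<^sub>C u + d *\<^sub>C u" by (rule add')
  show "c *\<^sub>C d *\<^sub>C u = (c * d) *\<^sub>C u" by (rule scale)
  show "of_real r *\<^sub>C u = r *\<^sub>R u" by (simp add: scaleR_atensor_def)
  show "r *\<^sub>R (u + v) = r *\<^sub>R u + r *\<^sub>R v" by (simp add: scaleR_atensor_def add)
  show "(r + r') *\<^sub>R u = r *\<^sub>R u + r' *\<^sub>R u" by (simp add: scaleR_atensor_def add')
  show "r *\<^sub>R r' *\<^sub>R u = (r * r') *\<^sub>R u" by (simp add: scaleR_atensor_def scale)
  show "1 *\<^sub>R u = u" by (simp add: scaleR_atensor_def one)
qed

end

lift_definition atensor_pure :: "'a :: complex_vector \<Rightarrow> 'b :: complex_vector \<Rightarrow> ('a, 'b) atensor" is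
  "\<lambda>a b. [(a, b)]" .

lemma abs_atensor_Cons: "abs_atensor ((a, b) # s) = atensor_pure a b + abs_atensor s"
  by transfer (simp add: tensor_eq.refl)

lemma abs_atensor_append: "abs_atensor (s @ t) = abs_atensor s + abs_atensor t"
  by transfer (simp add: tensor_eq.refl)

lemma abs_atensor_Nil: "abs_atensor [] = 0"
  by transfer (simp add: tensor_eq.refl)

lemma abs_atensor_scaleC: "abs_atensor (map (\<lambda>(a, b). (c *\<^sub>C a, b)) s) = c *\<^sub>C abs_atensor s"
  by transfer (simp add: tensor_eq.refl)

lemma atensor_abs_cases: obtains s where "u = abs_atensor s"
  by (metis Quotient_atensor Quotient_abs_rep)

lemma atensor_pure_add_left: "atensor_pure (a + a') b = atensor_pure a b + atensor_pure a' b"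
  by transfer (simp add: tensor_eq.add_left)

lemma atensor_pure_add_right: "atensor_pure a (b + b') = atensor_pure a b + atensor_pure a b'"
  by transfer (simp add: tensor_eq.add_right)

lemma atensor_pure_scaleC_left: "atensor_pure (c *\<^sub>C a) b = c *\<^sub>C atensor_pure a b"
  by transfer (simp add: tensor_eq.refl)

lemma atensor_pure_scaleC_right: "atensor_pure a (c *\<^sub>C b) = c *\<^sub>C atensor_pure a b"
  by transfer (auto intro: tensor_eq.scale tensor_eq.sym)


lifting_forget atensor.lifting


subsection \<open>The projective seminorm\<close>

definition tensor_cost ::
    "('a :: complex_normed_vector \<times> 'b :: complex_normed_vector) list \<Rightarrow> real" where
  "tensor_cost s = (\<Sum>(a, b)\<leftarrow>s. norm a * norm b)"

definition projnorm :: "('a :: complex_normed_vector, 'b :: complex_normed_vector) atensor \<Rightarrow> real" where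
  "projnorm u = Inf {tensor_cost s |s. abs_atensor s = u}"

lemma tensor_cost_nonneg: "0 \<le> tensor_cost s"
  unfolding tensor_cost_def by (rule sum_list_nonneg) auto

lemma tensor_cost_append: "tensor_cost (s @ t) = tensor_cost s + tensor_cost t"
  by (simp add: tensor_cost_def)

lemma tensor_cost_scaleC: "tensor_cost (map (\<lambda>(a, b). (c *\<^sub>C a, b)) s) = cmod c * tensor_cost s"
  by (induction s) (auto simp: tensor_cost_def norm_scaleC algebra_simps)

lemma projnorm_le: "projnorm (abs_atensor s) \<le> tensor_cost s"
  unfolding projnorm_def
  by (rule cInf_lower) (auto intro!: bdd_belowI[of _ 0] tensor_cost_nonneg)

lemma projnorm_greatest: "(\<And>s. abs_atensor s = u \<Longrightarrow> r \<le> tensor_cost s) \<Longrightarrow> r \<le> projnorm u"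
  unfolding projnorm_def by (rule cInf_greatest) (use atensor_abs_cases[of u] in blast)+

lemma projnorm_nonneg: "0 \<le> projnorm u"
  by (rule projnorm_greatest) (rule tensor_cost_nonneg)

lemma projnorm_approx:
  assumes "projnorm u < r"
  obtains s where "abs_atensor s = u" "tensor_cost s < r"
  using projnorm_greatest[of u r] assms by force

lemma projnorm_zero [simp]: "projnorm 0 = 0"
  by (rule antisym[OF _ projnorm_nonneg])
    (use projnorm_le[of "[]"] in \<open>simp add: abs_atensor_Nil tensor_cost_def\<close>)

lemma projnorm_pure_le: "projnorm (atensor_pure a b) \<le> norm a * norm b"
  using projnorm_le[of "[(a, b)]"] by (simp add: abs_atensor_Cons abs_atensor_Nil tensor_cost_def)

lemma projnorm_triangle: "projnorm (u + v) \<le> projnorm u + projnorm v"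
proof (rule field_le_epsilon)
  fix e :: real assume "0 < e"
  obtain s where s: "abs_atensor s = u" "tensor_cost s < projnorm u + e / 2"
    by (rule projnorm_approx[of u "projnorm u + e / 2"]) (use \<open>0 < e\<close> in auto)
  obtain t where t: "abs_atensor t = v" "tensor_cost t < projnorm v + e / 2"
    by (rule projnorm_approx[of v "projnorm v + e / 2"]) (use \<open>0 < e\<close> in auto)
  show "projnorm (u + v) \<le> projnorm u + projnorm v + e"
    using projnorm_le[of "s @ t"] s t by (simp add: abs_atensor_append tensor_cost_append)
qed

lemma projnorm_scaleC: "projnorm (c *\<^sub>C u) = cmod c * projnorm u"
proof -
  have le: "projnorm (c *\<^sub>C u) \<le> cmod c * projnorm u" if "c \<noteq> 0" for c and u :: "('a, 'b) atensor"
  proof -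
    have "projnorm (c *\<^sub>C u) / cmod c \<le> projnorm u"
    proof (rule projnorm_greatest)
      fix s assume "abs_atensor s = u"
      then show "projnorm (c *\<^sub>C u) / cmod c \<le> tensor_cost s"
        using projnorm_le[of "map (\<lambda>(a, b). (c *\<^sub>C a, b)) s"] \<open>c \<noteq> 0\<close>
        by (simp add: abs_atensor_scaleC tensor_cost_scaleC field_simps)
    qed
    then show ?thesis using \<open>c \<noteq> 0\<close> by (simp add: field_simps)
  qed
  show ?thesis
  proof (cases "c = 0")
    case False
    then show ?thesis
      using le[of c u] le[of "1 / c" "c *\<^sub>C u"]
      by (simp add: scaleC_scaleC norm_divide field_simps)
  qed simp
qed

lemma projnorm_minus: "projnorm (- u) = projnorm u"
  using projnorm_scaleC[of "-1" u] by (simp add: scaleC_minus_one)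

lemma projnorm_diff_commute: "projnorm (u - v) = projnorm (v - u)"
  using projnorm_minus[of "u - v"] by simp

lemma projnorm_triangle3: "projnorm (u - w) \<le> projnorm (u - v) + projnorm (v - w)"
  using projnorm_triangle[of "u - v" "v - w"] by simp

lemma projnorm_rev_triangle: "\<bar>projnorm u - projnorm v\<bar> \<le> projnorm (u - v)"
  using projnorm_triangle[of "u - v" v] projnorm_triangle[of "v - u" u] projnorm_diff_commute[of u v]
  by simp


subsection \<open>The completion\<close>

text \<open>Two Cauchy sequences are identified when their difference tends to zero. In particular this
  factors out any non-zero tensor of projective seminorm zero, so it is not needed here that the
  projective seminorm is in fact a norm.\<close>

definition proj_Cauchy ::
    "(nat \<Rightarrow> ('a :: complex_normed_vector, 'b :: complex_normed_vector) atensor) \<Rightarrow> bool" where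
  "proj_Cauchy U \<longleftrightarrow> (\<forall>e>0. \<exists>M. \<forall>m\<ge>M. \<forall>n\<ge>M. projnorm (U m - U n) < e)"

definition proj_equiv ::
    "(nat \<Rightarrow> ('a :: complex_normed_vector, 'b :: complex_normed_vector) atensor) \<Rightarrow>
      (nat \<Rightarrow> ('a, 'b) atensor) \<Rightarrow> bool" where
  "proj_equiv U V \<longleftrightarrow> proj_Cauchy U \<and> proj_Cauchy V \<and> (\<lambda>n. projnorm (U n - V n)) \<longlonglongrightarrow> 0"

lemma projnorm_tendsto_0:
  assumes "\<And>n. projnorm (U n) \<le> f n" "f \<longlonglongrightarrow> 0"
  shows "(\<lambda>n. projnorm (U n)) \<longlonglongrightarrow> 0"
  by (rule tendsto_sandwich[of "\<lambda>_. 0" _ _ f]) (use assms in \<open>auto simp: projnorm_nonneg\<close>)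

lemma proj_Cauchy_const [simp]: "proj_Cauchy (\<lambda>_. u)"
  by (auto simp: proj_Cauchy_def)

lemma proj_equiv_refl: "proj_Cauchy U \<Longrightarrow> proj_equiv U U"
  by (simp add: proj_equiv_def)

quotient_type (overloaded) ('a, 'b) ptensor =
    "nat \<Rightarrow> ('a :: complex_normed_vector, 'b :: complex_normed_vector) atensor" / partial: proj_equiv
proof (rule part_equivpI)
  show "\<exists>U :: nat \<Rightarrow> ('a, 'b) atensor. proj_equiv U U" by (rule exI[of _ "\<lambda>_. 0"]) (simp add: proj_equiv_def)
  show "symp (proj_equiv :: (nat \<Rightarrow> ('a, 'b) atensor) \<Rightarrow> _)"
    by (rule sympI) (auto simp: proj_equiv_def projnorm_diff_commute)
  show "transp (proj_equiv :: (nat \<Rightarrow> ('a, 'b) atensor) \<Rightarrow> _)"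
  proof (rule transpI)
    fix U V W :: "nat \<Rightarrow> ('a, 'b) atensor"
    assume a: "proj_equiv U V" "proj_equiv V W"
    have "(\<lambda>n. projnorm (U n - W n)) \<longlonglongrightarrow> 0"
      by (rule projnorm_tendsto_0[where f = "\<lambda>n. projnorm (U n - V n) + projnorm (V n - W n)"])
        (use a in \<open>auto simp: proj_equiv_def intro: projnorm_triangle3 tendsto_add_zero\<close>)
    with a show "proj_equiv U W" by (simp add: proj_equiv_def)
  qed
qed

lemma proj_Cauchy_add: "proj_Cauchy U \<Longrightarrow> proj_Cauchy V \<Longrightarrow> proj_Cauchy (\<lambda>n. U n + V n)"
  unfolding proj_Cauchy_def
proof (intro allI impI)
  fix e :: real
  assume U: "\<forall>e>0. \<exists>M. \<forall>m\<ge>M. \<forall>n\<ge>M. projnorm (U m - U n) < e"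
    and V: "\<forall>e>0. \<exists>M. \<forall>m\<ge>M. \<forall>n\<ge>M. projnorm (V m - V n) < e" and "0 < e"
  from U \<open>0 < e\<close> obtain M where M: "\<And>m n. M \<le> m \<Longrightarrow> M \<le> n \<Longrightarrow> projnorm (U m - U n) < e / 2"
    by (meson half_gt_zero)
  from V \<open>0 < e\<close> obtain N where N: "\<And>m n. N \<le> m \<Longrightarrow> N \<le> n \<Longrightarrow> projnorm (V m - V n) < e / 2"
    by (meson half_gt_zero)
  show "\<exists>M. \<forall>m\<ge>M. \<forall>n\<ge>M. projnorm (U m + V m - (U n + V n)) < e"
  proof (intro exI allI impI)
    fix m n assume "max M N \<le> m" "max M N \<le> n"
    then show "projnorm (U m + V m - (U n + V n)) < e"
      using M[of m n] N[of m n] projnorm_triangle[of "U m - U n" "V m - V n"] by (simp add: algebra_simps)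
  qed
qed

lemma proj_Cauchy_scaleC:
  assumes "proj_Cauchy U"
  shows "proj_Cauchy (\<lambda>n. c *\<^sub>C U n)"
proof (cases "c = 0")
  case False
  show ?thesis
    unfolding proj_Cauchy_def
  proof (intro allI impI)
    fix e :: real assume "0 < e"
    then have "0 < e / cmod c" using False by simp
    with assms obtain M where "\<And>m n. M \<le> m \<Longrightarrow> M \<le> n \<Longrightarrow> projnorm (U m - U n) < e / cmod c"
      unfolding proj_Cauchy_def by meson
    then show "\<exists>M. \<forall>m\<ge>M. \<forall>n\<ge>M. projnorm (c *\<^sub>C U m - c *\<^sub>C U n) < e"
      using False by (auto simp: projnorm_scaleC field_simps simp flip: scaleC_diff_right)
  qed
qed simp

lemma projnorm_convergent:
  assumes "proj_Cauchy U"
  shows "convergent (\<lambda>n. projnorm (U n))"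
proof -
  have "Cauchy (\<lambda>n. projnorm (U n))"
    unfolding Cauchy_def dist_real_def
    using assms[unfolded proj_Cauchy_def] projnorm_rev_triangle by (meson le_less_trans)
  then show ?thesis by (simp add: Cauchy_convergent_iff)
qed

lemma proj_equiv_Cauchy: "proj_equiv U U \<longleftrightarrow> proj_Cauchy U"
  by (simp add: proj_equiv_def)

instantiation ptensor :: (complex_normed_vector, complex_normed_vector) complex_normed_vector
begin

lift_definition zero_ptensor :: "('a, 'b) ptensor" is "\<lambda>_. 0" by (simp add: proj_equiv_def)
lift_definition plus_ptensor :: "('a, 'b) ptensor \<Rightarrow> ('a, 'b) ptensor \<Rightarrow> ('a, 'b) ptensor" is
  "\<lambda>U V n. U n + V n"
proof -
  fix U U' V V' :: "nat \<Rightarrow> ('a, 'b) atensor"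
  assume a: "proj_equiv U U'" "proj_equiv V V'"
  have "(\<lambda>n. projnorm (U n + V n - (U' n + V' n))) \<longlonglongrightarrow> 0"
  proof (rule projnorm_tendsto_0)
    show "projnorm (U n + V n - (U' n + V' n)) \<le> projnorm (U n - U' n) + projnorm (V n - V' n)" for n
      using projnorm_triangle[of "U n - U' n" "V n - V' n"] by (simp add: algebra_simps)
    show "(\<lambda>n. projnorm (U n - U' n) + projnorm (V n - V' n)) \<longlonglongrightarrow> 0"
      using a by (auto simp: proj_equiv_def intro: tendsto_add_zero)
  qed
  with a show "proj_equiv (\<lambda>n. U n + V n) (\<lambda>n. U' n + V' n)"
    by (simp add: proj_equiv_def proj_Cauchy_add)
qed
lift_definition scaleC_ptensor :: "complex \<Rightarrow> ('a, 'b) ptensor \<Rightarrow> ('a, 'b) ptensor" is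
  "\<lambda>c U n. c *\<^sub>C U n"
proof -
  fix c and U V :: "nat \<Rightarrow> ('a, 'b) atensor"
  assume a: "proj_equiv U V"
  then show "proj_equiv (\<lambda>n. c *\<^sub>C U n) (\<lambda>n. c *\<^sub>C V n)"
    by (auto simp: proj_equiv_def proj_Cauchy_scaleC projnorm_scaleC intro: tendsto_mult_right_zero
        simp flip: scaleC_diff_right)
qed
lift_definition norm_ptensor :: "('a, 'b) ptensor \<Rightarrow> real" is "\<lambda>U. lim (\<lambda>n. projnorm (U n))"
proof -
  fix U V :: "nat \<Rightarrow> ('a, 'b) atensor"
  assume a: "proj_equiv U V"
  then obtain l where l: "(\<lambda>n. projnorm (V n)) \<longlonglongrightarrow> l"
    using projnorm_convergent[of V] by (auto simp: proj_equiv_def convergent_def)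
  have "(\<lambda>n. projnorm (U n) - projnorm (V n)) \<longlonglongrightarrow> 0"
    by (rule Lim_null_comparison[of _ "\<lambda>n. projnorm (U n - V n)"])
      (use a in \<open>auto simp: proj_equiv_def projnorm_rev_triangle\<close>)
  from tendsto_add[OF this l] have "(\<lambda>n. projnorm (U n)) \<longlonglongrightarrow> l" by simp
  with l show "lim (\<lambda>n. projnorm (U n)) = lim (\<lambda>n. projnorm (V n))" by (simp add: limI)
qed
definition uminus_ptensor :: "('a, 'b) ptensor \<Rightarrow> ('a, 'b) ptensor" where
  "uminus_ptensor u = (-1) *\<^sub>C u"
definition minus_ptensor :: "('a, 'b) ptensor \<Rightarrow> ('a, 'b) ptensor \<Rightarrow> ('a, 'b) ptensor" where
  "minus_ptensor u v = u + (-1) *\<^sub>C v"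
definition scaleR_ptensor :: "real \<Rightarrow> ('a, 'b) ptensor \<Rightarrow> ('a, 'b) ptensor" where
  "scaleR_ptensor r u = of_real r *\<^sub>C u"
definition dist_ptensor :: "('a, 'b) ptensor \<Rightarrow> ('a, 'b) ptensor \<Rightarrow> real" where
  "dist_ptensor u v = norm (u - v)"
definition sgn_ptensor :: "('a, 'b) ptensor \<Rightarrow> ('a, 'b) ptensor" where
  "sgn_ptensor u = inverse (norm u) *\<^sub>R u"
definition uniformity_ptensor :: "(('a, 'b) ptensor \<times> ('a, 'b) ptensor) filter" where
  "uniformity_ptensor = (INF e\<in>{0<..}. principal {(x, y). dist x y < e})"
definition open_ptensor :: "('a, 'b) ptensor set \<Rightarrow> bool" where
  "open_ptensor S = (\<forall>x\<in>S. \<forall>\<^sub>F (x', y) in uniformity. x' = x \<longrightarrow> y \<in> S)"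

instance
proof
  fix u v w :: "('a, 'b) ptensor" and r r' :: real and c d :: complex
  have assoc: "u + v + w = u + (v + w)" for u v w :: "('a, 'b) ptensor"
    by transfer (simp add: proj_equiv_Cauchy proj_Cauchy_add add.assoc)
  have comm: "u + v = v + u" for u v :: "('a, 'b) ptensor"
    by transfer (simp add: proj_equiv_Cauchy proj_Cauchy_add add.commute)
  have zero: "0 + u = u" for u :: "('a, 'b) ptensor"
    by transfer simp
  have add: "c *\<^sub>C (u + v) = c *\<^sub>C u + c *\<^sub>C v" for c and u v :: "('a, 'b) ptensor"
    by transfer (simp add: proj_equiv_Cauchy proj_Cauchy_add proj_Cauchy_scaleC scaleC_add_right)
  have scale: "c *\<^sub>C d *\<^sub>C u = (c * d) *\<^sub>C u" for c d and u :: "('a, 'b) ptensor"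
    by transfer (simp add: proj_equiv_Cauchy proj_Cauchy_scaleC scaleC_scaleC)
  have one: "1 *\<^sub>C u = u" for u :: "('a, 'b) ptensor"
    by transfer simp
  have add': "(c + d) *\<^sub>C u = c *\<^sub>C u + d *\<^sub>C u" for c d and u :: "('a, 'b) ptensor"
    by transfer (simp add: proj_equiv_Cauchy proj_Cauchy_add proj_Cauchy_scaleC scaleC_add_left)
  have null: "0 *\<^sub>C u = 0" for u :: "('a, 'b) ptensor"
    by transfer (simp add: proj_equiv_def)
  have hom: "norm (c *\<^sub>C u) = cmod c * norm u" for c and u :: "('a, 'b) ptensor"
  proof transfer
    fix c and U :: "nat \<Rightarrow> ('a, 'b) atensor"
    assume "proj_equiv U U"
    then have "(\<lambda>n. projnorm (U n)) \<longlonglongrightarrow> lim (\<lambda>n. projnorm (U n))"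
      using projnorm_convergent[of U] by (simp add: proj_equiv_Cauchy convergent_LIMSEQ_iff)
    from tendsto_mult_left[OF this, of "cmod c"]
    show "lim (\<lambda>n. projnorm (c *\<^sub>C U n)) = cmod c * lim (\<lambda>n. projnorm (U n))"
      by (simp add: projnorm_scaleC limI)
  qed
  show "u + v + w = u + (v + w)" by (rule assoc)
  show "u + v = v + u" by (rule comm)
  show "0 + u = u" by (rule zero)
  show "- u + u = 0" using add'[of "-1" 1 u] by (simp add: uminus_ptensor_def one null)
  show "u - v = u + - v" by (simp add: uminus_ptensor_def minus_ptensor_def)
  show "c *\<^sub>C (u + v) = c *\<^sub>C u + c *\<^sub>C v" by (rule add)
  show "(c + d) *\<^sub>C u = c *\<^sub>C u + d *\<^sub>C u" by (rule add')
  show "c *\<^sub>C d *\<^sub>C u = (c * d) *\<^sub>C u" by (rule scale)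
  show "of_real r *\<^sub>C u = r *\<^sub>R u" by (simp add: scaleR_ptensor_def)
  show "r *\<^sub>R (u + v) = r *\<^sub>R u + r *\<^sub>R v" by (simp add: scaleR_ptensor_def add)
  show "(r + r') *\<^sub>R u = r *\<^sub>R u + r' *\<^sub>R u" by (simp add: scaleR_ptensor_def add')
  show "r *\<^sub>R r' *\<^sub>R u = (r * r') *\<^sub>R u" by (simp add: scaleR_ptensor_def scale)
  show "1 *\<^sub>R u = u" by (simp add: scaleR_ptensor_def one)
  show "dist u v = norm (u - v)" by (rule dist_ptensor_def)
  show "sgn u = inverse (norm u) *\<^sub>R u" by (rule sgn_ptensor_def)
  show "uniformity = (INF e\<in>{0<..}. principal {(x, y). dist x (y :: ('a, 'b) ptensor) < e})"
    by (rule uniformity_ptensor_def)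
  show "open V = (\<forall>x\<in>V. \<forall>\<^sub>F (x', y) in uniformity. x' = x \<longrightarrow> y \<in> V)" for V :: "('a, 'b) ptensor set"
    by (rule open_ptensor_def)
  show "norm (c *\<^sub>C u) = cmod c * norm u" by (rule hom)
  show "norm (r *\<^sub>R u) = \<bar>r\<bar> * norm u" by (simp add: scaleR_ptensor_def hom)
  show "norm u = 0 \<longleftrightarrow> u = 0"
  proof transfer
    fix U :: "nat \<Rightarrow> ('a, 'b) atensor"
    assume "proj_equiv U U"
    then have "proj_Cauchy U" by (simp add: proj_equiv_Cauchy)
    then have l: "(\<lambda>n. projnorm (U n)) \<longlonglongrightarrow> lim (\<lambda>n. projnorm (U n))"
      using projnorm_convergent[of U] by (simp add: convergent_LIMSEQ_iff)
    have "proj_equiv U (\<lambda>_. 0) \<longleftrightarrow> (\<lambda>n. projnorm (U n)) \<longlonglongrightarrow> 0"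
      using \<open>proj_Cauchy U\<close> by (simp add: proj_equiv_def)
    then show "lim (\<lambda>n. projnorm (U n)) = 0 \<longleftrightarrow> proj_equiv U (\<lambda>_. 0)"
      using l LIMSEQ_unique[OF l] by metis
  qed
  show "norm (u + v) \<le> norm u + norm v"
  proof transfer
    fix U V :: "nat \<Rightarrow> ('a, 'b) atensor"
    assume "proj_equiv U U" "proj_equiv V V"
    then have C: "proj_Cauchy U" "proj_Cauchy V" by (simp_all add: proj_equiv_Cauchy)
    show "lim (\<lambda>n. projnorm (U n + V n)) \<le> lim (\<lambda>n. projnorm (U n)) + lim (\<lambda>n. projnorm (V n))"
    proof (rule LIMSEQ_le)
      show "(\<lambda>n. projnorm (U n + V n)) \<longlonglongrightarrow> lim (\<lambda>n. projnorm (U n + V n))"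
        using projnorm_convergent[OF proj_Cauchy_add[OF C]] by (simp add: convergent_LIMSEQ_iff)
      show "(\<lambda>n. projnorm (U n) + projnorm (V n)) \<longlonglongrightarrow> lim (\<lambda>n. projnorm (U n)) + lim (\<lambda>n. projnorm (V n))"
        using projnorm_convergent[OF C(1)] projnorm_convergent[OF C(2)]
        by (intro tendsto_add) (simp_all add: convergent_LIMSEQ_iff)
    qed (auto intro: projnorm_triangle)
  qed
qed

end

text \<open>The canonical map of the algebraic tensor product into its completion, and elementary
  tensors.\<close>

lift_definition ptensor_of ::
    "('a :: complex_normed_vector, 'b :: complex_normed_vector) atensor \<Rightarrow> ('a, 'b) ptensor" is
  "\<lambda>u _. u" by (simp add: proj_equiv_def)

definition ptensor_pure ::
    "'a :: complex_normed_vector \<Rightarrow> 'b :: complex_normed_vector \<Rightarrow> ('a, 'b) ptensor"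
    (infixr \<open>\<otimes>\<^sub>p\<close> 72) where
  "a \<otimes>\<^sub>p b = ptensor_of (atensor_pure a b)"

lemma ptensor_of_add: "ptensor_of (u + v) = ptensor_of u + ptensor_of v"
  by transfer (simp add: proj_equiv_def)

lemma ptensor_of_scaleC: "ptensor_of (c *\<^sub>C u) = c *\<^sub>C ptensor_of u"
  by transfer (simp add: proj_equiv_def)

lemma ptensor_of_zero: "ptensor_of 0 = 0"
  by transfer (simp add: proj_equiv_def)

lemma ptensor_of_diff: "ptensor_of (u - v) = ptensor_of u - ptensor_of v"
  using ptensor_of_add[of "u - v" v] by (simp add: algebra_simps)

lemma norm_ptensor_of: "norm (ptensor_of u) = projnorm u"
  by transfer (simp add: limI)

lemma ptensor_of_tendsto:
  assumes "proj_Cauchy U"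
  shows "(\<lambda>n. ptensor_of (U n)) \<longlonglongrightarrow> abs_ptensor U"
proof (rule LIMSEQ_I)
  fix e :: real assume "0 < e"
  then obtain M where M: "\<And>m n. M \<le> m \<Longrightarrow> M \<le> n \<Longrightarrow> projnorm (U m - U n) < e / 2"
    using assms unfolding proj_Cauchy_def by (meson half_gt_zero)
  have "norm (ptensor_of (U m) - abs_ptensor U) < e" if "M \<le> m" for m
  proof -
    have C: "proj_Cauchy (\<lambda>n. U m + (-1) *\<^sub>C U n)"
      by (intro proj_Cauchy_add proj_Cauchy_scaleC assms proj_Cauchy_const)
    have "ptensor_of (U m) - abs_ptensor U = abs_ptensor (\<lambda>n. U m + (-1) *\<^sub>C U n)"
      unfolding minus_ptensor_def ptensor_of.abs_eq
      by (simp add: scaleC_ptensor.abs_eq plus_ptensor.abs_eq proj_equiv_Cauchy assms proj_Cauchy_scaleC)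
    then have "norm (ptensor_of (U m) - abs_ptensor U) = lim (\<lambda>n. projnorm (U m - U n))"
      using C by (simp add: norm_ptensor.abs_eq proj_equiv_Cauchy scaleC_minus_one)
    also have "\<dots> \<le> e / 2"
    proof (rule LIMSEQ_le_const2)
      show "(\<lambda>n. projnorm (U m - U n)) \<longlonglongrightarrow> lim (\<lambda>n. projnorm (U m - U n))"
        using projnorm_convergent[OF C] by (simp add: convergent_LIMSEQ_iff scaleC_minus_one)
      show "\<exists>N. \<forall>n\<ge>N. projnorm (U m - U n) \<le> e / 2"
        using M[OF that] by (meson less_imp_le)
    qed
    finally show ?thesis using \<open>0 < e\<close> by simp
  qed
  then show "\<exists>M. \<forall>m\<ge>M. norm (ptensor_of (U m) - abs_ptensor U) < e" by blast
qed

lemma ptensor_abs_cases: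
  obtains U where "proj_Cauchy U" "u = abs_ptensor U"
  by (metis Quotient_ptensor Quotient_abs_rep Quotient_rep_reflp proj_equiv_Cauchy)

lemma ptensor_of_dense:
  assumes "0 < e"
  shows "\<exists>v. norm (u - ptensor_of v) < e"
proof -
  obtain U where U: "proj_Cauchy U" "u = abs_ptensor U" by (rule ptensor_abs_cases)
  from LIMSEQ_D[OF ptensor_of_tendsto[OF U(1)] assms] show ?thesis
    unfolding U(2) by (metis norm_minus_commute order_refl)
qed

instance ptensor :: (complex_normed_vector, complex_normed_vector) cbanach
proof
  fix X :: "nat \<Rightarrow> ('a, 'b) ptensor"
  assume X: "Cauchy X"
  have "\<forall>n. \<exists>v. norm (X n - ptensor_of v) < inverse (real (Suc n))"
    by (intro allI ptensor_of_dense) simp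
  then obtain V where V: "\<And>n. norm (X n - ptensor_of (V n)) < inverse (real (Suc n))" by metis
  have null: "(\<lambda>n. X n - ptensor_of (V n)) \<longlonglongrightarrow> 0"
    by (rule Lim_null_comparison[OF _ LIMSEQ_inverse_real_of_nat])
      (use V in \<open>blast intro: always_eventually less_imp_le\<close>)
  have "Cauchy (\<lambda>n. ptensor_of (V n))"
  proof (rule CauchyI)
    fix e :: real assume "0 < e"
    then have e: "0 < e / 3" by simp
    obtain M where M: "\<And>m n. M \<le> m \<Longrightarrow> M \<le> n \<Longrightarrow> norm (X m - X n) < e / 3"
      using CauchyD[OF X e] by blast
    obtain N where N: "\<And>n. N \<le> n \<Longrightarrow> norm (X n - ptensor_of (V n)) < e / 3"
      using LIMSEQ_D[OF null e] by auto
    have "norm (ptensor_of (V m) - ptensor_of (V n)) < e" if "max M N \<le> m" "max M N \<le> n" for m n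
    proof -
      have "ptensor_of (V m) - ptensor_of (V n) =
          (X m - X n) - (X m - ptensor_of (V m)) + (X n - ptensor_of (V n))" by simp
      also have "norm \<dots> \<le> norm (X m - X n) + norm (X m - ptensor_of (V m)) + norm (X n - ptensor_of (V n))"
        by (intro norm_triangle_mono norm_triangle_ineq4 order_refl)
      also have "\<dots> < e" using M[of m n] N[of m] N[of n] that by simp
      finally show ?thesis .
    qed
    then show "\<exists>M. \<forall>m\<ge>M. \<forall>n\<ge>M. norm (ptensor_of (V m) - ptensor_of (V n)) < e" by blast
  qed
  then have "proj_Cauchy V"
    by (simp add: Cauchy_def proj_Cauchy_def dist_norm norm_ptensor_of flip: ptensor_of_diff)
  from tendsto_add[OF null ptensor_of_tendsto[OF this]] show "convergent X"
    by (auto simp: convergent_def)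
qed

lemma ptensor_pure_add_left: "(a + a') \<otimes>\<^sub>p b = a \<otimes>\<^sub>p b + a' \<otimes>\<^sub>p b"
  by (simp add: ptensor_pure_def atensor_pure_add_left ptensor_of_add)

lemma ptensor_pure_add_right: "a \<otimes>\<^sub>p (b + b') = a \<otimes>\<^sub>p b + a \<otimes>\<^sub>p b'"
  by (simp add: ptensor_pure_def atensor_pure_add_right ptensor_of_add)

lemma ptensor_pure_scaleC_left: "(c *\<^sub>C a) \<otimes>\<^sub>p b = c *\<^sub>C (a \<otimes>\<^sub>p b)"
  by (simp add: ptensor_pure_def atensor_pure_scaleC_left ptensor_of_scaleC)

lemma ptensor_pure_scaleC_right: "a \<otimes>\<^sub>p (c *\<^sub>C b) = c *\<^sub>C (a \<otimes>\<^sub>p b)"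
  by (simp add: ptensor_pure_def atensor_pure_scaleC_right ptensor_of_scaleC)

lemma norm_ptensor_pure_le: "norm (a \<otimes>\<^sub>p b) \<le> norm a * norm b"
  by (simp add: ptensor_pure_def norm_ptensor_of projnorm_pure_le)


subsection \<open>Linearisation of bounded bilinear maps\<close>

definition bounded_cbilinear ::
    "('a :: complex_normed_vector \<Rightarrow> 'b :: complex_normed_vector \<Rightarrow> 'c :: complex_normed_vector) \<Rightarrow> bool" where
  "bounded_cbilinear B \<longleftrightarrow> (\<forall>b. clinear (\<lambda>a. B a b)) \<and> (\<forall>a. clinear (B a)) \<and>
     (\<exists>K. \<forall>a b. norm (B a b) \<le> norm a * norm b * K)"

text \<open>The bounded linear map determined by \<open>a \<otimes> b \<mapsto> B a b\<close>.\<close>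

definition ptensor_lift ::
    "('a :: complex_normed_vector \<Rightarrow> 'b :: complex_normed_vector \<Rightarrow> 'c :: cbanach) \<Rightarrow> ('a, 'b) ptensor \<Rightarrow>\<^sub>C\<^sub>L 'c" where
  "ptensor_lift B = (THE T. \<forall>a b. T *\<^sub>V (a \<otimes>\<^sub>p b) = B a b)"

lemma cblinfun_apply_tendsto: "X \<longlonglongrightarrow> x \<Longrightarrow> (\<lambda>n. T *\<^sub>V X n) \<longlonglongrightarrow> T *\<^sub>V x"
  by (rule bounded_linear.tendsto) (use bounded_clinear_apply[of T] in \<open>simp_all add: bounded_clinear_iff\<close>)

lemma cblinfun_apply_zero: "T *\<^sub>V 0 = 0"
  using cblinfun_apply_add[of T 0 0] by simp

lemma cblinfun_ptensor_eqI:
  fixes S T :: "('a :: complex_normed_vector, 'b :: complex_normed_vector) ptensor \<Rightarrow>\<^sub>C\<^sub>L 'c :: complex_normed_vector"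
  assumes "\<And>a b. S *\<^sub>V (a \<otimes>\<^sub>p b) = T *\<^sub>V (a \<otimes>\<^sub>p b)"
  shows "S = T"
proof (rule cblinfun_eqI)
  fix u :: "('a, 'b) ptensor"
  have of: "S *\<^sub>V ptensor_of v = T *\<^sub>V ptensor_of v" for v
  proof -
    obtain s where v: "v = abs_atensor s" by (rule atensor_abs_cases)
    have "S *\<^sub>V ptensor_of (abs_atensor s) = T *\<^sub>V ptensor_of (abs_atensor s)"
    proof (induction s)
      case (Cons x s)
      then show ?case using assms
        by (cases x) (simp add: abs_atensor_Cons ptensor_of_add cblinfun_apply_add ptensor_pure_def)
    qed (simp add: abs_atensor_Nil ptensor_of_zero cblinfun_apply_zero)
    then show ?thesis by (simp add: v)
  qed
  obtain U where U: "proj_Cauchy U" "u = abs_ptensor U" by (rule ptensor_abs_cases)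
  note lim = cblinfun_apply_tendsto[OF ptensor_of_tendsto[OF U(1)]]
  show "S *\<^sub>V u = T *\<^sub>V u"
    unfolding U(2) by (rule LIMSEQ_unique[OF lim[of S]]) (use lim[of T] in \<open>simp add: of\<close>)
qed

lemma ptensor_lift_exists:
  fixes B :: "'a :: complex_normed_vector \<Rightarrow> 'b :: complex_normed_vector \<Rightarrow> 'c :: cbanach"
  assumes "bounded_cbilinear B"
  shows "\<exists>T :: ('a, 'b) ptensor \<Rightarrow>\<^sub>C\<^sub>L 'c. \<forall>a b. T *\<^sub>V (a \<otimes>\<^sub>p b) = B a b"
proof -
  from assms obtain K0 where
    add1: "\<And>a a' b. B (a + a') b = B a b + B a' b" and add2: "\<And>a b b'. B a (b + b') = B a b + B a b'" and
    sc1: "\<And>c a b. B (c *\<^sub>C a) b = c *\<^sub>C B a b" and sc2: "\<And>c a b. B a (c *\<^sub>C b) = c *\<^sub>C B a b" and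
    K0: "\<And>a b. norm (B a b) \<le> norm a * norm b * K0"
    by (auto simp: bounded_cbilinear_def clinear_def)
  define K where "K = \<bar>K0\<bar>"
  have K: "norm (B a b) \<le> K * (norm a * norm b)" "0 \<le> K" for a b
    using order_trans[OF K0[of a b] mult_left_mono[OF abs_ge_self[of K0], of "norm a * norm b"]]
    by (auto simp: K_def mult_ac)
  have B0: "B 0 b = 0" for b using sc1[of 0 0 b] by simp
  define g where "g s = (\<Sum>(a, b)\<leftarrow>s. B a b)" for s
  have g_append: "g (s @ t) = g s + g t" for s t by (simp add: g_def)
  have g_eq: "tensor_eq s t \<Longrightarrow> g s = g t" for s t
    by (induction rule: tensor_eq.induct)
      (auto simp: g_append add.commute, auto simp: g_def add1 add2 sc1 sc2 B0)
  have g_scaleC: "g (map (\<lambda>(a, b). (c *\<^sub>C a, b)) s) = c *\<^sub>C g s" for c s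
    by (induction s) (auto simp: g_def sc1 scaleC_add_right)
  have g_norm: "norm (g s) \<le> K * tensor_cost s" for s
  proof (induction s)
    case (Cons x s)
    obtain a b where x: "x = (a, b)" by fastforce
    show ?case
      using Cons K(1)[of a b] norm_triangle_ineq[of "B a b" "g s"]
      by (simp add: x g_def tensor_cost_def algebra_simps)
  qed (simp add: g_def tensor_cost_def)
  define h where "h u = g (rep_atensor u)" for u
  have h: "h (abs_atensor s) = g s" for s
    unfolding h_def by (rule g_eq) (metis Quotient_atensor Quotient_rep_abs tensor_eq.refl)
  have h_add: "h (u + v) = h u + h v" for u v
    by (metis atensor_abs_cases abs_atensor_append h g_append)
  have h_scaleC: "h (c *\<^sub>C u) = c *\<^sub>C h u" for c u
    by (metis atensor_abs_cases abs_atensor_scaleC h g_scaleC)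
  have h_diff: "h (u - v) = h u - h v" for u v
    using h_add[of "u - v" v] by simp
  have h_pure: "h (atensor_pure a b) = B a b" for a b
    by (simp add: atensor_pure.abs_eq h g_def)
  have h_norm: "norm (h u) \<le> K * projnorm u" for u
  proof (rule field_le_epsilon)
    fix e :: real assume "0 < e"
    then have "projnorm u < projnorm u + e / (K + 1)" using K(2) by simp
    then obtain s where s: "abs_atensor s = u" "tensor_cost s < projnorm u + e / (K + 1)"
      by (rule projnorm_approx)
    have "norm (h u) \<le> K * tensor_cost s" using g_norm[of s] h[of s] s(1) by simp
    also have "\<dots> \<le> K * (projnorm u + e / (K + 1))" using s(2) K(2) by (intro mult_left_mono) auto
    also have "\<dots> = K * projnorm u + e * (K / (K + 1))" by (simp add: algebra_simps)
    also have "\<dots> \<le> K * projnorm u + e"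
      using K(2) \<open>0 < e\<close> by (intro add_left_mono mult_left_le) auto
    finally show "norm (h u) \<le> K * projnorm u + e" .
  qed
  have conv: "convergent (\<lambda>n. h (U n))" if U: "proj_Cauchy U" for U
  proof -
    have "Cauchy (\<lambda>n. h (U n))"
    proof (rule CauchyI)
      fix e :: real assume "0 < e"
      then have "0 < e / (K + 1)" using K(2) by simp
      with U obtain M where M: "\<And>m n. M \<le> m \<Longrightarrow> M \<le> n \<Longrightarrow> projnorm (U m - U n) < e / (K + 1)"
        unfolding proj_Cauchy_def by meson
      have "norm (h (U m) - h (U n)) < e" if "M \<le> m" "M \<le> n" for m n
      proof -
        have "norm (h (U m) - h (U n)) \<le> K * projnorm (U m - U n)"
          using h_norm[of "U m - U n"] by (simp add: h_diff)
        also have "\<dots> \<le> (K + 1) * projnorm (U m - U n)"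
          by (intro mult_right_mono projnorm_nonneg) simp
        also have "\<dots> < e" using M[OF that] K(2) by (simp add: field_simps)
        finally show ?thesis .
      qed
      then show "\<exists>M. \<forall>m\<ge>M. \<forall>n\<ge>M. norm (h (U m) - h (U n)) < e" by blast
    qed
    then show ?thesis by (simp add: Cauchy_convergent_iff)
  qed
  define T where "T u = lim (\<lambda>n. h (rep_ptensor u n))" for u
  have T_lim: "(\<lambda>n. h (U n)) \<longlonglongrightarrow> T (abs_ptensor U)" if U: "proj_Cauchy U" for U
  proof -
    define V where "V = rep_ptensor (abs_ptensor U)"
    have UV: "proj_equiv U V"
      unfolding V_def using U by (metis Quotient_ptensor Quotient_rep_abs proj_equiv_Cauchy
          Quotient_part_equivp part_equivp_symp)
    then have V: "(\<lambda>n. h (V n)) \<longlonglongrightarrow> T (abs_ptensor U)"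
      using conv[of V] by (simp add: T_def proj_equiv_def convergent_LIMSEQ_iff flip: V_def)
    have "(\<lambda>n. h (U n) - h (V n)) \<longlonglongrightarrow> 0"
    proof (rule Lim_null_comparison)
      show "\<forall>\<^sub>F n in sequentially. norm (h (U n) - h (V n)) \<le> K * projnorm (U n - V n)"
        using h_norm by (simp flip: h_diff)
      show "(\<lambda>n. K * projnorm (U n - V n)) \<longlonglongrightarrow> 0"
        using UV by (auto simp: proj_equiv_def intro: tendsto_mult_right_zero)
    qed
    from tendsto_add[OF this V] show ?thesis by simp
  qed
  have T_of: "T (ptensor_of u) = h u" for u
    using T_lim[OF proj_Cauchy_const[of u]] by (simp add: ptensor_of.abs_eq LIMSEQ_const_iff)
  have "bounded_clinear T"
    unfolding bounded_clinear_def clinear_def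
  proof (intro conjI allI exI)
    fix u v :: "('a, 'b) ptensor" and c
    obtain U where U: "proj_Cauchy U" "u = abs_ptensor U" by (rule ptensor_abs_cases)
    obtain V where V: "proj_Cauchy V" "v = abs_ptensor V" by (rule ptensor_abs_cases)
    have "u + v = abs_ptensor (\<lambda>n. U n + V n)"
      using U V by (simp add: plus_ptensor.abs_eq proj_equiv_Cauchy)
    then show "T (u + v) = T u + T v"
      using LIMSEQ_unique[OF T_lim[OF proj_Cauchy_add[OF U(1) V(1)]]] tendsto_add[OF T_lim[OF U(1)] T_lim[OF V(1)]]
      by (simp add: U(2) V(2) h_add)
    have "c *\<^sub>C u = abs_ptensor (\<lambda>n. c *\<^sub>C U n)"
      using U by (simp add: scaleC_ptensor.abs_eq proj_equiv_Cauchy)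
    then show "T (c *\<^sub>C u) = c *\<^sub>C T u"
      using LIMSEQ_unique[OF T_lim[OF proj_Cauchy_scaleC[OF U(1), of c]]]
        bounded_linear.tendsto[OF bounded_linear_scaleC T_lim[OF U(1)], of c]
      by (simp add: U(2) h_scaleC)
    show "norm (T u) \<le> norm u * K"
    proof (rule LIMSEQ_le)
      show "(\<lambda>n. norm (h (U n))) \<longlonglongrightarrow> norm (T u)"
        unfolding U(2) by (intro tendsto_norm T_lim U(1))
      show "(\<lambda>n. norm (ptensor_of (U n)) * K) \<longlonglongrightarrow> norm u * K"
        unfolding U(2) by (intro tendsto_intros ptensor_of_tendsto U(1))
      show "\<exists>N. \<forall>n\<ge>N. norm (h (U n)) \<le> norm (ptensor_of (U n)) * K"
        using h_norm by (simp add: norm_ptensor_of mult.commute)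
    qed
  qed
  then have "\<forall>a b. CBlinfun T *\<^sub>V (a \<otimes>\<^sub>p b) = B a b"
    by (simp add: ptensor_pure_def T_of h_pure)
  then show ?thesis by blast
qed

lemma ptensor_lift_pure:
  assumes "bounded_cbilinear B"
  shows "ptensor_lift B *\<^sub>V (a \<otimes>\<^sub>p b) = B a b"
proof -
  obtain T where T: "\<forall>a b. T *\<^sub>V (a \<otimes>\<^sub>p b) = B a b"
    using ptensor_lift_exists[OF assms] by blast
  then have "\<forall>a b. ptensor_lift B *\<^sub>V (a \<otimes>\<^sub>p b) = B a b"
    unfolding ptensor_lift_def by (rule theI) (use T in \<open>auto intro!: cblinfun_ptensor_eqI\<close>)
  then show ?thesis by blast
qed


section \<open>Banach algebras, characters and biflatness\<close>

text \<open>The product is an explicit parameter, because algebras with the same underlying Banach space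
  but different products have to be considered. No unit is assumed.\<close>

locale banach_algebra =
  fixes mul :: "'a :: cbanach \<Rightarrow> 'a \<Rightarrow> 'a"
  assumes mul_assoc: "mul (mul a b) c = mul a (mul b c)"
    and clinear_mul_left: "clinear (\<lambda>a. mul a b)"
    and clinear_mul_right: "clinear (mul a)"
    and norm_mul_le: "norm (mul a b) \<le> norm a * norm b"

text \<open>The product of \<open>A\<^sub>e\<close>.\<close>

definition sandwich_mul :: "('a \<Rightarrow> 'a \<Rightarrow> 'a) \<Rightarrow> 'a \<Rightarrow> 'a \<Rightarrow> 'a \<Rightarrow> 'a" where
  "sandwich_mul mul e a b = mul (mul a e) b"

text \<open>Boundedness is automatic for multiplicative functionals; see \<open>norm_character_le\<close> below.\<close>

definition characters :: "('a :: cbanach \<Rightarrow> 'a \<Rightarrow> 'a) \<Rightarrow> ('a \<Rightarrow> complex) set" where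
  "characters mul =
     {\<phi>. clinear \<phi> \<and> (\<forall>a b. \<phi> (mul a b) = \<phi> a * \<phi> b) \<and> (\<exists>a. \<phi> a \<noteq> 0)}"

text \<open>The bimodule structure of the projective tensor square: \<open>ptensor_lact mul a u = a \<cdot> u\<close> and
  \<open>ptensor_ract mul a u = u \<cdot> a\<close>.\<close>

definition ptensor_lact ::
    "('a :: cbanach \<Rightarrow> 'a \<Rightarrow> 'a) \<Rightarrow> 'a \<Rightarrow> ('a, 'a) ptensor \<Rightarrow>\<^sub>C\<^sub>L ('a, 'a) ptensor" where
  "ptensor_lact mul a = ptensor_lift (\<lambda>b c. mul a b \<otimes>\<^sub>p c)"

definition ptensor_ract ::
    "('a :: cbanach \<Rightarrow> 'a \<Rightarrow> 'a) \<Rightarrow> 'a \<Rightarrow> ('a, 'a) ptensor \<Rightarrow>\<^sub>C\<^sub>L ('a, 'a) ptensor" where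
  "ptensor_ract mul a = ptensor_lift (\<lambda>b c. b \<otimes>\<^sub>p mul c a)"

definition mult_map :: "('a :: cbanach \<Rightarrow> 'a \<Rightarrow> 'a) \<Rightarrow> ('a, 'a) ptensor \<Rightarrow>\<^sub>C\<^sub>L 'a" where
  "mult_map mul = ptensor_lift mul"

text \<open>Dual bimodules: \<open>(a \<cdot> f)(x) = f (x \<cdot> a)\<close> and \<open>(f \<cdot> a)(x) = f (a \<cdot> x)\<close>, so that the left action on
  the dual comes from the right action \<open>R\<close> on the space and vice versa.\<close>

definition dual_lact ::
    "('a \<Rightarrow> 'x :: complex_normed_vector \<Rightarrow>\<^sub>C\<^sub>L 'x) \<Rightarrow> 'a \<Rightarrow> 'x cdual \<Rightarrow>\<^sub>C\<^sub>L 'x cdual" where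
  "dual_lact R a = adj (R a)"

definition dual_ract ::
    "('a \<Rightarrow> 'x :: complex_normed_vector \<Rightarrow>\<^sub>C\<^sub>L 'x) \<Rightarrow> 'a \<Rightarrow> 'x cdual \<Rightarrow>\<^sub>C\<^sub>L 'x cdual" where
  "dual_ract L a = adj (L a)"

definition bidual_lact ::
    "('a :: cbanach \<Rightarrow> 'a \<Rightarrow> 'a) \<Rightarrow> 'a \<Rightarrow> ('a, 'a) ptensor cdual cdual \<Rightarrow>\<^sub>C\<^sub>L ('a, 'a) ptensor cdual cdual" where
  "bidual_lact mul = dual_lact (dual_ract (ptensor_lact mul))"

definition bidual_ract ::
    "('a :: cbanach \<Rightarrow> 'a \<Rightarrow> 'a) \<Rightarrow> 'a \<Rightarrow> ('a, 'a) ptensor cdual cdual \<Rightarrow>\<^sub>C\<^sub>L ('a, 'a) ptensor cdual cdual" where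
  "bidual_ract mul = dual_ract (dual_lact (ptensor_ract mul))"

text \<open>The extension of a bounded functional to the second dual, \<open>F \<mapsto> F(\<phi>)\<close>.\<close>

definition functional_ext :: "('a :: cbanach \<Rightarrow> complex) \<Rightarrow> 'a cdual cdual \<Rightarrow> complex" where
  "functional_ext \<phi> F = F *\<^sub>V CBlinfun \<phi>"

definition biflat_at :: "('a :: cbanach \<Rightarrow> 'a \<Rightarrow> 'a) \<Rightarrow> ('a \<Rightarrow> complex) \<Rightarrow> bool" where
  "biflat_at mul \<phi> \<longleftrightarrow>
     (\<exists>\<rho> :: 'a \<Rightarrow>\<^sub>C\<^sub>L ('a, 'a) ptensor cdual cdual.
        (\<forall>a x. \<rho> *\<^sub>V mul a x = bidual_lact mul a *\<^sub>V \<rho> *\<^sub>V x) \<and>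
        (\<forall>a x. \<rho> *\<^sub>V mul x a = bidual_ract mul a *\<^sub>V \<rho> *\<^sub>V x) \<and>
        functional_ext \<phi> \<circ> cblinfun_apply (adj (adj (mult_map mul))) \<circ> cblinfun_apply \<rho> = \<phi>)"

context banach_algebra
begin

lemma bounded_cbilinear_mul: "bounded_cbilinear mul"
  using clinear_mul_left clinear_mul_right norm_mul_le
  by (auto simp: bounded_cbilinear_def intro!: exI[of _ 1])

lemma mult_map_pure: "mult_map mul *\<^sub>V (a \<otimes>\<^sub>p b) = mul a b"
  unfolding mult_map_def by (rule ptensor_lift_pure[OF bounded_cbilinear_mul])

lemma ptensor_lact_pure: "ptensor_lact mul a *\<^sub>V (b \<otimes>\<^sub>p c) = mul a b \<otimes>\<^sub>p c"
  unfolding ptensor_lact_def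
proof (rule ptensor_lift_pure)
  have "norm (mul a b \<otimes>\<^sub>p c) \<le> norm b * norm c * norm a" for b c
    using order_trans[OF norm_ptensor_pure_le[of "mul a b" c] mult_right_mono[OF norm_mul_le[of a b]]]
    by (simp add: mult_ac)
  then show "bounded_cbilinear (\<lambda>b c. mul a b \<otimes>\<^sub>p c)"
    using clinear_mul_right[of a]
    by (auto simp: bounded_cbilinear_def clinear_def ptensor_pure_add_left ptensor_pure_add_right
        ptensor_pure_scaleC_left ptensor_pure_scaleC_right)
qed

lemma ptensor_ract_pure: "ptensor_ract mul a *\<^sub>V (b \<otimes>\<^sub>p c) = b \<otimes>\<^sub>p mul c a"
  unfolding ptensor_ract_def
proof (rule ptensor_lift_pure)
  have "norm (b \<otimes>\<^sub>p mul c a) \<le> norm b * norm c * norm a" for b c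
    using order_trans[OF norm_ptensor_pure_le[of b "mul c a"] mult_left_mono[OF norm_mul_le[of c a]]]
    by (simp add: mult_ac)
  then show "bounded_cbilinear (\<lambda>b c. b \<otimes>\<^sub>p mul c a)"
    using clinear_mul_left[of a]
    by (auto simp: bounded_cbilinear_def clinear_def ptensor_pure_add_left ptensor_pure_add_right
        ptensor_pure_scaleC_left ptensor_pure_scaleC_right)
qed

lemma banach_algebra_sandwich_mul:
  assumes "norm e \<le> 1"
  shows "banach_algebra (sandwich_mul mul e)"
proof
  fix a b c
  show "sandwich_mul mul e (sandwich_mul mul e a b) c = sandwich_mul mul e a (sandwich_mul mul e b c)"
    by (simp add: sandwich_mul_def mul_assoc)
  show "clinear (\<lambda>a. sandwich_mul mul e a b)"
    using clinear_mul_left by (simp add: clinear_def sandwich_mul_def)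
  show "clinear (sandwich_mul mul e a)"
    using clinear_mul_right by (simp add: clinear_def sandwich_mul_def)
  have "norm (mul a e) \<le> norm a"
    using order_trans[OF norm_mul_le[of a e] mult_left_mono[OF assms, of "norm a"]] by simp
  then show "norm (sandwich_mul mul e a b) \<le> norm a * norm b"
    using order_trans[OF norm_mul_le[of "mul a e" b] mult_right_mono[of _ _ "norm b"]]
    by (simp add: sandwich_mul_def)
qed

lemma characters_sandwich_mul:
  assumes "\<phi> \<in> characters mul" "\<phi> e \<noteq> 0"
  shows "(\<lambda>a. \<phi> e * \<phi> a) \<in> characters (sandwich_mul mul e)"
  using assms by (auto simp: characters_def clinear_def sandwich_mul_def scaleC_complex_def algebra_simps)

lemma norm_character_le:
  assumes "\<phi> \<in> characters mul"
  shows "cmod (\<phi> x) \<le> norm x"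
proof (rule ccontr)
  assume "\<not> cmod (\<phi> x) \<le> norm x"
  then have less: "norm x < cmod (\<phi> x)" by simp
  then have nz: "\<phi> x \<noteq> 0" by (smt (verit) norm_ge_zero norm_zero)
  from assms have add: "\<phi> (a + b) = \<phi> a + \<phi> b" and sc: "\<phi> (c *\<^sub>C a) = c * \<phi> a"
    and mult: "\<phi> (mul a b) = \<phi> a * \<phi> b" for a b c
    by (auto simp: characters_def clinear_def scaleC_complex_def)
  define y where "y = (1 / \<phi> x) *\<^sub>C x"
  have y: "\<phi> y = 1" "norm y < 1"
    using less nz by (auto simp: y_def sc norm_scaleC norm_divide field_simps)
  define f where "f n = (mul y ^^ n) y" for n
  have f0: "f 0 = y" and fSuc: "mul y (f n) = f (Suc n)" for n by (simp_all add: f_def)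
  have "norm (f n) \<le> norm y ^ n" for n
  proof (induction n)
    case (Suc n)
    have "norm (f (Suc n)) \<le> norm y * norm (f n)"
      using norm_mul_le[of y "f n"] by (simp add: f_def)
    also have "\<dots> \<le> norm y * norm y ^ n" by (intro mult_left_mono Suc) simp
    finally show ?case by simp
  qed (use y in \<open>simp add: f_def\<close>)
  then have f: "summable f"
    using summable_comparison_test[of f "\<lambda>n. norm y ^ n"] y(2) by (auto intro: summable_geometric)
  have "bounded_clinear (mul y)"
    using clinear_mul_right[of y] norm_mul_le[of y]
    by (auto simp: bounded_clinear_def mult.commute[of "norm y"])
  then have "mul y (\<Sum>n. f n) = (\<Sum>n. mul y (f n))"
    using bounded_linear.suminf[OF _ f, of "mul y"] by (simp add: bounded_clinear_iff)
  also have "\<dots> = (\<Sum>n. f (Suc n))" by (simp add: fSuc)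
  also have "\<dots> = (\<Sum>n. f n) - y" using suminf_split_head[OF f] by (simp add: f0)
  finally have "(\<Sum>n. f n) = mul y (\<Sum>n. f n) + y" by simp
  from arg_cong[OF this, of \<phi>] show False by (simp add: add mult y(1))
qed

lemma bounded_clinear_character: "\<phi> \<in> characters mul \<Longrightarrow> bounded_clinear \<phi>"
  using norm_character_le[of \<phi>]
  by (auto simp: bounded_clinear_def characters_def intro!: exI[of _ 1])

end

lemma bidual_lact_apply:
  "(bidual_lact mul a *\<^sub>V F) *\<^sub>V f = F *\<^sub>V dual_ract (ptensor_lact mul) a *\<^sub>V f"
  by (simp add: bidual_lact_def dual_lact_def)

lemma bidual_ract_apply:
  "(bidual_ract mul a *\<^sub>V F) *\<^sub>V f = F *\<^sub>V dual_lact (ptensor_ract mul) a *\<^sub>V f"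
  by (simp add: bidual_ract_def dual_ract_def)

end

theory Submission
  imports Defs
begin

text \<open>
  Write \<open>a \<star> b = aeb\<close> for the product of \<open>A\<^sub>e\<close>. On the tensor square, acting by \<open>a\<close> in the sense
  of \<open>A\<^sub>e\<close> is acting by \<open>ae\<close> from the left and by \<open>ea\<close> from the right in the sense of \<open>A\<close>, and this
  passes to the second dual. As also \<open>a \<star> x = (ae)x\<close> and \<open>x \<star> a = x(ea)\<close>, every \<open>A\<close>-bimodule
  morphism \<open>\<rho> : A \<rightarrow> (A \<otimes>\<^sub>p A)\<^sup>*\<^sup>*\<close> is automatically an \<open>A\<^sub>e\<close>-bimodule morphism.

  Only the normalisation changes. With \<open>\<psi> = \<phi>(e) \<phi>\<close>, the functional \<open>\<psi> \<circ> \<pi>\<close> formed with the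
  product of \<open>A\<^sub>e\<close> sends \<open>b \<otimes> c\<close> to \<open>\<phi>(e) \<phi>(bec) = \<phi>(e)\<^sup>2 \<phi>(b) \<phi>(c)\<close>, so it is \<open>\<phi>(e)\<^sup>2\<close> times
  \<open>\<phi> \<circ> \<pi>\<close> formed with the product of \<open>A\<close>. Hence a \<open>\<rho>\<close> that witnesses \<open>\<phi>\<close>-biflatness of \<open>A\<close> yields
  \<open>\<phi>(e)\<^sup>2 \<phi>\<close> on \<open>A\<^sub>e\<close> where \<open>\<psi>\<close> is wanted, and \<open>\<phi>(e)\<^sup>-\<^sup>1 \<rho>\<close> witnesses \<open>\<psi>\<close>-biflatness of \<open>A\<^sub>e\<close>.
\<close>

lemma bidual_lact_sandwich_mul:
  "bidual_lact (sandwich_mul mul e) a = bidual_lact mul (mul a e)"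
  by (simp add: bidual_lact_def dual_lact_def dual_ract_def ptensor_lact_def sandwich_mul_def)

context banach_algebra
begin

lemma bidual_ract_sandwich_mul:
  "bidual_ract (sandwich_mul mul e) a = bidual_ract mul (mul e a)"
  by (simp add: bidual_ract_def dual_lact_def dual_ract_def ptensor_ract_def sandwich_mul_def mul_assoc)

text \<open>Both sides are bounded functionals on the tensor square, so it suffices to compare them on
  elementary tensors. One factor \<open>\<phi> e\<close> comes from the character of \<open>A\<^sub>e\<close>, the other from its
  product.\<close>

lemma character_mult_map_sandwich_mul:
  assumes \<phi>: "\<phi> \<in> characters mul" and e: "norm e \<le> 1" "\<phi> e \<noteq> 0"
  shows "adj (mult_map (sandwich_mul mul e)) *\<^sub>V CBlinfun (\<lambda>a. \<phi> e * \<phi> a) =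
    (\<phi> e)\<^sup>2 *\<^sub>C (adj (mult_map mul) *\<^sub>V CBlinfun \<phi>)"
proof (rule cblinfun_ptensor_eqI)
  interpret e: banach_algebra "sandwich_mul mul e"
    using e(1) by (rule banach_algebra_sandwich_mul)
  have "bounded_clinear (\<lambda>a. \<phi> e * \<phi> a)"
    by (intro e.bounded_clinear_character characters_sandwich_mul \<phi> e)
  moreover have "\<phi> (mul a b) = \<phi> a * \<phi> b" for a b
    using \<phi> by (simp add: characters_def)
  ultimately show "(adj (mult_map (sandwich_mul mul e)) *\<^sub>V CBlinfun (\<lambda>a. \<phi> e * \<phi> a)) *\<^sub>V (b \<otimes>\<^sub>p c) =
      ((\<phi> e)\<^sup>2 *\<^sub>C (adj (mult_map mul) *\<^sub>V CBlinfun \<phi>)) *\<^sub>V (b \<otimes>\<^sub>p c)" for b c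
    by (simp add: cblinfun_scaleC_apply e.mult_map_pure mult_map_pure bounded_clinear_character[OF \<phi>]
        sandwich_mul_def scaleC_complex_def power2_eq_square)
qed

end

theorem corollary2p7:
  fixes mul :: "'a :: cbanach \<Rightarrow> 'a \<Rightarrow> 'a" and \<phi> :: "'a \<Rightarrow> complex" and e :: 'a
  assumes "banach_algebra mul"
    and "\<phi> \<in> characters mul"
    and "norm e \<le> 1"
    and "\<phi> e \<noteq> 0"
    and "biflat_at mul \<phi>"
  shows "biflat_at (sandwich_mul mul e) (\<lambda>a. \<phi> e * \<phi> a)"
proof -
  interpret banach_algebra mul by fact
  obtain \<rho> :: "'a \<Rightarrow>\<^sub>C\<^sub>L ('a, 'a) ptensor cdual cdual"
    where left: "\<And>a x. \<rho> *\<^sub>V mul a x = bidual_lact mul a *\<^sub>V \<rho> *\<^sub>V x"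
      and right: "\<And>a x. \<rho> *\<^sub>V mul x a = bidual_ract mul a *\<^sub>V \<rho> *\<^sub>V x"
      and normalised: "functional_ext \<phi> \<circ> cblinfun_apply (adj (adj (mult_map mul))) \<circ> cblinfun_apply \<rho> = \<phi>"
    using assms(5) unfolding biflat_at_def by blast
  have \<rho>_\<phi>: "(\<rho> *\<^sub>V a) *\<^sub>V adj (mult_map mul) *\<^sub>V CBlinfun \<phi> = \<phi> a" for a
    using fun_cong[OF normalised, of a] by (simp add: functional_ext_def)
  define \<sigma> where "\<sigma> = inverse (\<phi> e) *\<^sub>C \<rho>"
  have "\<sigma> *\<^sub>V sandwich_mul mul e a x = bidual_lact (sandwich_mul mul e) a *\<^sub>V \<sigma> *\<^sub>V x" for a x
    by (simp add: \<sigma>_def cblinfun_scaleC_apply cblinfun_apply_scaleC bidual_lact_sandwich_mul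
        sandwich_mul_def left)
  moreover have "\<sigma> *\<^sub>V sandwich_mul mul e x a = bidual_ract (sandwich_mul mul e) a *\<^sub>V \<sigma> *\<^sub>V x" for a x
    by (simp add: \<sigma>_def cblinfun_scaleC_apply cblinfun_apply_scaleC bidual_ract_sandwich_mul
        sandwich_mul_def mul_assoc flip: right)
  moreover have "functional_ext (\<lambda>a. \<phi> e * \<phi> a) \<circ>
      cblinfun_apply (adj (adj (mult_map (sandwich_mul mul e)))) \<circ> cblinfun_apply \<sigma> = (\<lambda>a. \<phi> e * \<phi> a)"
    using assms(4)
    by (auto simp: fun_eq_iff functional_ext_def character_mult_map_sandwich_mul[OF assms(2-4)]
        \<sigma>_def cblinfun_scaleC_apply cblinfun_apply_scaleC \<rho>_\<phi> scaleC_complex_def power2_eq_square)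
  ultimately show ?thesis
    unfolding biflat_at_def by blast
qed

end
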